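(* The matrix $A$ is $Q$-polynomial with respect to the vertex $\mathbf 0$; that is, there exists an ordering $E_0,E_1,\dots,E_N$ of the primitive idempotents of $A$ and a matrix $B\in{\rm Mat}_X(\mathbb C)$ that generates the algebra $M^*$ and satisfies \[ B E_iV\subseteq E_{i-1}V+E_iV+E_{i+1}V\qquad(0\le i\le N), \] where $E_{-1}=0$ and $E_{N+1}=0$.
   Context: Let $q$ be a prime power, $GF(q)$ the field with $q$ elements, $N\ge 1$ an integer, and $\mathbf V$ an $N$-dimensional vector space over $GF(q)$. Let $X$ be the set of all subspaces of $\mathbf V$, partially ordered by inclusion (the projective geometry $L_N(q)$); elements of $X$ are called vertices, and $\mathbf 0\in X$ is the zero subspace. For $y,z\in X$, $y$ covers $z$ means $z\subseteq y$ and $\dim y-\dim z=1$; $y,z$ are adjacent if one covers the other. ${\rm Mat}_X(\mathbb C)$ is the algebra of complex matrices with rows and columns indexed by $X$; it acts on $V=\mathbb C^X$ by left multiplication. Subalgebras contain the identity matrix $I$. Fix a real number $\varphi>0$. The matrix $A\in{\rm Mat}_X(\mathbb C)$ has $(y,z)$-entry $1$ if $y$ covers $z$; $\varphi q^{\dim y}$ if $z$ covers $y$; $\frac{\varphi-1}{q-1}q^{\dim y}$ if $y=z$; and $0$ otherwise. For a diagonalizable matrix $B$ and an eigenvalue $\theta$ of $B$, the primitive idempotent of $B$ for $\theta$ is the matrix acting as the identity on the $\theta$-eigenspace of $B$ and as $0$ on every other eigenspace. It is a fact that $A$ is diagonalizable with exactly $N+1$ distinct eigenvalues, hence it has $N+1$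 primitive idempotents. For $0\le i\le N$, $E^*_i\in{\rm Mat}_X(\mathbb C)$ is the diagonal matrix with $(y,y)$-entry $1$ if $\dim y=i$ and $0$ otherwise. $M^*$ is the (commutative) subalgebra of ${\rm Mat}_X(\mathbb C)$ with basis $E^*_0,\dots,E^*_N$ (the dual adjacency algebra with respect to $\mathbf 0$). Terminology: given an ordering $E_0,\dots,E_N$ of the primitive idempotents of $A$ (with $E_{-1}=E_{N+1}=0$), a matrix $B$ is a dual adjacency matrix with respect to $\mathbf 0$ and this ordering if $B$ generates $M^*$ and $BE_iV\subseteq E_{i-1}V+E_iV+E_{i+1}V$ for $0\le i\le N$. The ordering is $Q$-polynomial with respect to $\mathbf 0$ if such a $B$ exists, and $A$ is $Q$-polynomial with respect to $\mathbf 0$ if some ordering of its primitive idempotents is $Q$-polynomial with respect to $\mathbf 0$. *)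

theory Defs
  imports "HOL-Analysis.Analysis"
begin

text \<open>
  A vector space over \<open>GF(q)\<close> is given by a scalar multiplication \<open>smul\<close> of a finite field \<open>'f\<close>
  (so \<open>q = CARD('f)\<close>) on an additive group \<open>'v\<close>.  So that the library's matrices can be used, the
  set \<open>X\<close> of all its subspaces is indexed by a finite type \<open>'x\<close>: the bijection \<open>vertex\<close> sends an
  index to the subspace it stands for.  Thus \<open>Mat\<^sub>X(\<complex>)\<close> is \<open>complex^'x^'x\<close> and \<open>\<complex>\<^sup>X\<close> is
  \<open>complex^'x\<close>.
\<close>

definition enumerates_subspaces ::
  "('f::field \<Rightarrow> 'v::ab_group_add \<Rightarrow> 'v) \<Rightarrow> ('x \<Rightarrow> 'v set) \<Rightarrow> bool" where
  "enumerates_subspaces smul vertex \<longleftrightarrow>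
     bij_betw vertex UNIV {S. module.subspace smul S}"

definition covers ::
  "('f::field \<Rightarrow> 'v::ab_group_add \<Rightarrow> 'v) \<Rightarrow> 'v set \<Rightarrow> 'v set \<Rightarrow> bool" where
  "covers smul y z \<longleftrightarrow>
     z \<subseteq> y \<and> vector_space.dim smul y = vector_space.dim smul z + 1"

definition adj_matrix ::
  "('f::{field,finite} \<Rightarrow> 'v::ab_group_add \<Rightarrow> 'v) \<Rightarrow> ('x::finite \<Rightarrow> 'v set) \<Rightarrow> real \<Rightarrow> complex^'x^'x"
where
  "adj_matrix smul vertex \<phi> = (\<chi> y z.
     let q = real CARD('f); d = vector_space.dim smul (vertex y) in
     if covers smul (vertex y) (vertex z) then 1
     else if covers smul (vertex z) (vertex y) then complex_of_real (\<phi> * q ^ d)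
     else if y = z then complex_of_real ((\<phi> - 1) / (q - 1) * q ^ d)
     else 0)"


definition eigenspace :: "complex^'x^'x \<Rightarrow> complex \<Rightarrow> (complex^'x) set" where
  "eigenspace B \<theta> = {v. B *v v = \<theta> *s v}"

definition is_eigenvalue :: "complex^'x^'x \<Rightarrow> complex \<Rightarrow> bool" where
  "is_eigenvalue B \<theta> \<longleftrightarrow> (\<exists>v. v \<noteq> 0 \<and> v \<in> eigenspace B \<theta>)"

definition diagonalizable :: "complex^'x^'x \<Rightarrow> bool" where
  "diagonalizable B \<longleftrightarrow>
     (\<exists>P D :: complex^'x^'x. invertible P \<and> (\<forall>i j. i \<noteq> j \<longrightarrow> D $ i $ j = 0) \<and> B = P ** D ** matrix_inv P)"

text \<open>
  Diagonalizability is part of the definition: it is what makes \<open>E\<close> unique for given \<open>B\<close>, \<open>\<theta>\<close>.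
\<close>

definition primitive_idempotent :: "complex^'x^'x \<Rightarrow> complex \<Rightarrow> complex^'x^'x \<Rightarrow> bool" where
  "primitive_idempotent B \<theta> E \<longleftrightarrow> diagonalizable B \<and> is_eigenvalue B \<theta> \<and>
     (\<forall>v \<in> eigenspace B \<theta>. E *v v = v) \<and>
     (\<forall>\<mu>. is_eigenvalue B \<mu> \<and> \<mu> \<noteq> \<theta> \<longrightarrow> (\<forall>v \<in> eigenspace B \<mu>. E *v v = 0))"

definition primitive_idempotents :: "complex^'x^'x \<Rightarrow> (complex^'x^'x) set" where
  "primitive_idempotents B = {E. \<exists>\<theta>. primitive_idempotent B \<theta> E}"


text \<open>
  The library's scalar multiplication \<open>*s\<close> on \<open>complex^'x^'x\<close> is not by complex numbers
  (it scales by vectors \<open>complex^'x\<close>), hence the following.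
\<close>

definition scale_matrix :: "complex \<Rightarrow> complex^'x^'x \<Rightarrow> complex^'x^'x" where
  "scale_matrix c = map_matrix ((*) c)"

lemma vector_space_scale_matrix: "vector_space scale_matrix"
  by standard (simp_all add: scale_matrix_def vec_eq_iff algebra_simps)

definition subalgebra :: "(complex^'x^'x) set \<Rightarrow> bool" where
  "subalgebra S \<longleftrightarrow> module.subspace scale_matrix S \<and> mat 1 \<in> S \<and>
     (\<forall>B \<in> S. \<forall>C \<in> S. B ** C \<in> S)"

definition dual_idempotent ::
  "('f::field \<Rightarrow> 'v::ab_group_add \<Rightarrow> 'v) \<Rightarrow> ('x::finite \<Rightarrow> 'v set) \<Rightarrow> nat \<Rightarrow> complex^'x^'x" where
  "dual_idempotent smul vertex i =
     (\<chi> y z. if y = z \<and> vector_space.dim smul (vertex y) = i then 1 else 0)"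

definition dual_adj_algebra ::
  "('f::field \<Rightarrow> 'v::ab_group_add \<Rightarrow> 'v) \<Rightarrow> ('x::finite \<Rightarrow> 'v set) \<Rightarrow> nat \<Rightarrow> (complex^'x^'x) set"
where
  "dual_adj_algebra smul vertex N =
     module.span scale_matrix (dual_idempotent smul vertex ` {0..N})"

text \<open>
  Orderings \<open>E\<^sub>0, \<dots>, E\<^sub>N\<close> are indexed by \<open>int\<close> so that \<open>E\<^bsub>-1\<^esub> = E\<^bsub>N+1\<^esub> = 0\<close> can be stated literally.
\<close>

definition idempotent_ordering :: "complex^'x^'x \<Rightarrow> nat \<Rightarrow> (int \<Rightarrow> complex^'x^'x) \<Rightarrow> bool" where
  "idempotent_ordering A N E \<longleftrightarrow>
     bij_betw E {0..int N} (primitive_idempotents A) \<and> E (-1) = 0 \<and> E (int N + 1) = 0"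

text \<open>In the following definition, \<open>+\<close> is the elementwise sum of sets of vectors.\<close>

definition dual_adj_matrix ::
  "('f::field \<Rightarrow> 'v::ab_group_add \<Rightarrow> 'v) \<Rightarrow> ('x::finite \<Rightarrow> 'v set) \<Rightarrow> nat \<Rightarrow>
   (int \<Rightarrow> complex^'x^'x) \<Rightarrow> complex^'x^'x \<Rightarrow> bool" where
  "dual_adj_matrix smul vertex N E B \<longleftrightarrow>
     subalgebra hull {B} = dual_adj_algebra smul vertex N \<and>
     (\<forall>i \<in> {0..int N}.
        (*v) B ` range ((*v) (E i)) \<subseteq>
          range ((*v) (E (i - 1))) + range ((*v) (E i)) + range ((*v) (E (i + 1))))"

definition Q_polynomial ::
  "('f::field \<Rightarrow> 'v::ab_group_add \<Rightarrow> 'v) \<Rightarrow> ('x::finite \<Rightarrow> 'v set) \<Rightarrow> nat \<Rightarrow> complex^'x^'x \<Rightarrow> bool"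
where
  "Q_polynomial smul vertex N A \<longleftrightarrow>
     (\<exists>E. idempotent_ordering A N E \<and> (\<exists>B. dual_adj_matrix smul vertex N E B))"

end

theory Submission
  imports Defs
begin

text \<open>
  For \<open>c \<noteq> 0\<close> and a subspace \<open>W\<close> let \<open>\<mu>\<^sub>W\<close> be the vector with \<open>\<mu>\<^sub>W(y) = c\<^bsup>dim y\<^esup>\<close> for \<open>y \<subseteq> W\<close> and \<open>0\<close>
  elsewhere; these vectors form a basis. For the two roots \<open>c = 1\<close> and \<open>c = -1/\<phi>\<close> of
  \<open>(1 - c)(1 + \<phi>c) = 0\<close>, subspace counting shows that \<open>A \<mu>\<^sub>W\<close> is a multiple of \<open>\<mu>\<^sub>W\<close> plus \<open>1/c\<close> times the
  sum of the \<open>\<mu>\<^sub>Y\<close> with \<open>Y\<close> covering \<open>W\<close>; with \<open>\<theta>\<^sub>i = (\<phi>q\<^bsup>N-i\<^esup> - q\<^sup>i)/(q - 1)\<close>, the multiple is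
  \<open>\<theta>\<^bsub>N - dim W\<^esub>\<close> for \<open>c = 1\<close> and \<open>\<theta>\<^bsub>dim W\<^esub>\<close> for \<open>c = -1/\<phi>\<close>. So the spans \<open>F\<^sub>k\<close> of the \<open>\<mu>\<^sub>W\<close> with
  \<open>dim W \<ge> k\<close> are sums of eigenspaces of \<open>A\<close>, and the two values of \<open>c\<close> give opposite orders of
  the eigenvalues. For either \<open>c\<close>, \<open>B = diag(q\<^bsup>-dim y\<^esup>)\<close> maps \<open>\<mu>\<^sub>W\<close> into the span of \<open>\<mu>\<^sub>W\<close> and the
  \<open>\<mu>\<^sub>Z\<close> with \<open>Z\<close> covered by \<open>W\<close>, so \<open>B F\<^sub>k \<subseteq> F\<^bsub>k-1\<^esub>\<close>. One flag bounds the components of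
  \<open>B E\<^sub>i v\<close> from above by \<open>i + 1\<close>, the other from below by \<open>i - 1\<close>.
\<close>

section \<open>Counting subspaces over a finite field\<close>

locale finite_field_space = finite_dimensional_vector_space smul Basis
  for smul :: "'f::{field,finite} \<Rightarrow> 'v::ab_group_add \<Rightarrow> 'v" and Basis +
  fixes q :: real
  assumes q_eq: "q = real CARD('f)"
begin

lemma q_gt_1: "q > 1"
proof -
  have "card {0, 1 :: 'f} \<le> CARD('f)"
    by (rule card_mono) auto
  then show ?thesis by (simp add: q_eq)
qed

lemma card_span_insert:
  assumes "v \<notin> span S"
  shows "card (span (insert v S)) = CARD('f) * card (span S)"
proof -
  have "bij_betw (\<lambda>(c, x). smul c v + x) (UNIV \<times> span S) (span (insert v S))"
    unfolding bij_betw_def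
  proof
    show "inj_on (\<lambda>(c, x). smul c v + x) (UNIV \<times> span S)"
    proof (rule inj_onI, clarify)
      fix c x c' x'
      assume xs: "x \<in> span S" "x' \<in> span S" and eq: "smul c v + x = smul c' v + x'"
      have diff: "smul (c - c') v = x' - x"
        using eq by (simp add: scale_left_diff_distrib algebra_simps)
      have "c = c'"
      proof (rule ccontr)
        assume "c \<noteq> c'"
        then have "v = smul (inverse (c - c')) (x' - x)"
          by (simp flip: diff)
        then show False
          using assms xs by (auto intro!: span_scale span_diff)
      qed
      with eq show "c = c' \<and> x = x'" by simp
    qed
    show "(\<lambda>(c, x). smul c v + x) ` (UNIV \<times> span S) = span (insert v S)"
    proof (intro set_eqI iffI)
      fix y assume "y \<in> (\<lambda>(c, x). smul c v + x) ` (UNIV \<times> span S)"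
      then obtain c x where "x \<in> span S" "y = smul c v + x" by auto
      then show "y \<in> span (insert v S)"
        by (auto simp: span_insert intro!: exI[of _ c])
    next
      fix y assume "y \<in> span (insert v S)"
      then obtain c where "y - smul c v \<in> span S" by (auto simp: span_insert)
      then show "y \<in> (\<lambda>(c, x). smul c v + x) ` (UNIV \<times> span S)"
        by (intro image_eqI[of _ _ "(c, y - smul c v)"]) auto
    qed
  qed
  from bij_betw_same_card[OF this] show ?thesis
    by (simp add: card_cartesian_product)
qed

lemma card_subspace:
  assumes "subspace S"
  shows "card S = CARD('f) ^ dim S"
proof -
  have "card (span B) = CARD('f) ^ card B" if "finite B" "independent B" for B
    using that
  proof (induction B rule: finite_induct)
    case (insert x B)
    have "x \<notin> span B" "independent B"
      using insert.prems insert.hyps by (auto simp: independent_insert)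
    with insert show ?case by (simp add: card_span_insert)
  qed auto
  moreover obtain B where "B \<subseteq> S" "independent B" "S \<subseteq> span B" "card B = dim S"
    using basis_exists by blast
  moreover from this have "span B = S"
    using assms by (metis span_subspace)
  ultimately show ?thesis
    using finiteI_independent by metis
qed

lemma finite_subspace: "subspace S \<Longrightarrow> finite S"
  using card_subspace[of S] by (intro card_ge_0_finite) simp

lemma finite_vectors: "finite (A :: 'v set)"
  using finite_subspace[OF subspace_UNIV] by (rule rev_finite_subset) simp

lemma real_card_diff_subspace:
  assumes "subspace S" "subspace T" "S \<subseteq> T"
  shows "real (card (T - S)) = q ^ dim T - q ^ dim S"
  using assms card_mono[OF finite_vectors assms(3)]
  by (simp add: card_Diff_subset finite_vectors card_subspace of_nat_diff q_eq)

lemma span_insert_eq_of_dim: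
  assumes "subspace S" "subspace T" "S \<subseteq> T" "dim T = dim S + 1" "v \<in> T" "v \<notin> S"
  shows "span (insert v S) = T"
proof (rule subspace_dim_equal)
  show "span (insert v S) \<subseteq> T" using assms by (simp add: span_minimal)
  show "dim T \<le> dim (span (insert v S))"
    using assms by (simp add: dim_insert span_eq_iff[THEN iffD2])
qed (use assms in auto)

lemma card_covers:
  assumes S: "subspace S" and T: "subspace T" and "S \<subseteq> T"
  shows "(q - 1) * real (card {Y. subspace Y \<and> S \<subseteq> Y \<and> Y \<subseteq> T \<and> dim Y = dim S + 1})
         = q ^ (dim T - dim S) - 1"
proof -
  let ?C = "{Y. subspace Y \<and> S \<subseteq> Y \<and> Y \<subseteq> T \<and> dim Y = dim S + 1}"
  have "T - S = (\<Union>Y\<in>?C. Y - S)"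
  proof (intro set_eqI iffI)
    fix v assume v: "v \<in> T - S"
    have "span (insert v S) \<subseteq> T"
      using v assms by (intro span_minimal) auto
    moreover have "S \<subseteq> span (insert v S)"
      by (auto intro: span_base)
    moreover have "dim (span (insert v S)) = dim S + 1"
      using v S by (simp add: dim_insert span_eq_iff[THEN iffD2])
    ultimately have "span (insert v S) \<in> ?C" by simp
    then show "v \<in> (\<Union>Y\<in>?C. Y - S)"
      using v by (intro UN_I[of "span (insert v S)"]) (auto intro: span_base)
  qed auto
  also have "card \<dots> = (\<Sum>Y\<in>?C. card (Y - S))"
  proof (rule card_UN_disjoint)
    show "finite ?C" by (rule finite_subset[of _ "Pow T"]) (auto simp: finite_vectors)
    show "\<forall>Y\<in>?C. \<forall>Z\<in>?C. Y \<noteq> Z \<longrightarrow> (Y - S) \<inter> (Z - S) = {}"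
    proof (intro ballI impI)
      have eq: "span (insert v S) = Y" if "Y \<in> ?C" "v \<in> Y - S" for v Y
        using that by (intro span_insert_eq_of_dim[OF S]) auto
      fix Y Z assume YZ: "Y \<in> ?C" "Z \<in> ?C" "Y \<noteq> Z"
      show "(Y - S) \<inter> (Z - S) = {}"
      proof (rule equals0I)
        fix v assume "v \<in> (Y - S) \<inter> (Z - S)"
        then show False using eq[OF YZ(1), of v] eq[OF YZ(2), of v] YZ(3) by simp
      qed
    qed
  qed (auto simp: finite_vectors)
  finally have "real (card (T - S)) = (\<Sum>Y\<in>?C. real (card (Y - S)))" by simp
  also have "\<dots> = (\<Sum>Y\<in>?C. q ^ (dim S + 1) - q ^ dim S)"
    by (rule sum.cong) (auto simp: real_card_diff_subspace S)
  finally have *: "q ^ dim T - q ^ dim S = real (card ?C) * (q ^ (dim S + 1) - q ^ dim S)"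
    by (simp add: real_card_diff_subspace assms)
  have "q ^ dim T = q ^ (dim T - dim S) * q ^ dim S"
    using dim_subset[OF \<open>S \<subseteq> T\<close>] by (simp flip: power_add)
  with * have "q ^ dim S * ((q - 1) * real (card ?C)) = q ^ dim S * (q ^ (dim T - dim S) - 1)"
    by (simp add: algebra_simps)
  then show ?thesis using q_gt_1 by simp
qed

lemma card_hyperplanes:
  assumes "subspace S" and T: "subspace T" and "S \<subseteq> T"
  shows "(q - 1) * real (card {Y. subspace Y \<and> S \<subseteq> Y \<and> Y \<subseteq> T \<and> dim T = dim Y + 1})
         = q ^ (dim T - dim S) - 1"
  using assms(1,3)
proof (induction "dim T - dim S" arbitrary: S)
  case 0
  then have "S = T" using T by (intro subspace_dim_equal) auto
  then have "{Y. subspace Y \<and> S \<subseteq> Y \<and> Y \<subseteq> T \<and> dim T = dim Y + 1} = {}" by auto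
  with \<open>S = T\<close> show ?case by (simp only: card.empty) simp
next
  case (Suc n)
  let ?H = "\<lambda>S. {Y. subspace Y \<and> S \<subseteq> Y \<and> Y \<subseteq> T \<and> dim T = dim Y + 1}"
  have fin: "finite (?H S)" for S
    by (rule finite_subset[of _ "Pow T"]) (auto simp: finite_vectors)
  have dT: "dim T = dim S + Suc n" using Suc.hyps(2) by simp
  show ?case
  proof (cases "n = 0")
    case True
    have "?H S = {S}"
    proof (intro set_eqI iffI)
      fix Y assume "Y \<in> ?H S"
      then have "S = Y" using Suc.prems dT True by (intro subspace_dim_equal) auto
      then show "Y \<in> {S}" by simp
    qed (use Suc.prems dT True in auto)
    then show ?thesis using dT True by simp
  next
    case False
    \<comment> \<open>Count the pairs \<open>(Y, v)\<close> with \<open>Y\<close> a hyperplane and \<open>v \<notin> Y\<close>; those with \<open>v \<in> Y\<close> fall under the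
      induction hypothesis for \<open>span (insert v S)\<close>. The resulting recursion degenerates for \<open>n = 0\<close>.\<close>
    have "real (card (?H S)) * (q ^ dim T - q ^ (dim T - 1)) = (\<Sum>Y\<in>?H S. real (card (T - Y)))"
    proof -
      have "real (card (T - Y)) = q ^ dim T - q ^ (dim T - 1)" if "Y \<in> ?H S" for Y
        using that by (simp add: real_card_diff_subspace T)
      then have "(\<Sum>Y\<in>?H S. real (card (T - Y))) = (\<Sum>Y\<in>?H S. q ^ dim T - q ^ (dim T - 1))"
        by (rule sum.cong[OF refl])
      then show ?thesis by (simp only: sum_constant)
    qed
    also have "\<dots> = (\<Sum>Y\<in>?H S. \<Sum>v\<in>T. if v \<notin> Y then 1 else 0)"
      by (simp add: sum.If_cases finite_vectors Diff_eq Compl_eq)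
    also have "\<dots> = (\<Sum>v\<in>T. \<Sum>Y\<in>?H S. if v \<notin> Y then 1 else 0)"
      by (rule sum.swap)
    also have "\<dots> = (\<Sum>v\<in>T - S. \<Sum>Y\<in>?H S. if v \<notin> Y then 1 else 0)"
      by (rule sum.mono_neutral_right) (auto simp: finite_vectors intro!: sum.neutral)
    also have "\<dots> = (\<Sum>v\<in>T - S. real (card (?H S)) - (q ^ n - 1) / (q - 1))"
    proof (rule sum.cong[OF refl])
      fix v assume v: "v \<in> T - S"
      let ?S = "span (insert v S)"
      have sub: "?S \<subseteq> Y \<longleftrightarrow> v \<in> Y \<and> S \<subseteq> Y" if "subspace Y" for Y
        using that span_minimal[of "insert v S" Y] by (auto intro: span_base)
      have "dim ?S = dim S + 1"
        using v Suc.prems by (simp add: dim_insert span_eq_iff[THEN iffD2])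
      then have "(q - 1) * real (card (?H ?S)) = q ^ n - 1"
        using Suc.hyps(1)[of ?S] dT v Suc.prems by (simp add: sub T)
      then have card': "real (card (?H ?S)) = (q ^ n - 1) / (q - 1)"
        using q_gt_1 by (simp add: field_simps)
      have H': "?H ?S = {Y \<in> ?H S. v \<in> Y}"
        using sub by blast
      have "?H S = {Y \<in> ?H S. v \<notin> Y} \<union> ?H ?S" "{Y \<in> ?H S. v \<notin> Y} \<inter> ?H ?S = {}"
        unfolding H' by blast+
      then have "card (?H S) = card {Y \<in> ?H S. v \<notin> Y} + card (?H ?S)"
        using fin by (metis (no_types, lifting) card_Un_disjoint finite_Un)
      moreover have "(\<Sum>Y\<in>?H S. if v \<notin> Y then 1 else 0) = real (card {Y \<in> ?H S. v \<notin> Y})"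
        using fin by (simp flip: sum.inter_filter)
      ultimately show "(\<Sum>Y\<in>?H S. if v \<notin> Y then 1 else 0) = real (card (?H S)) - (q ^ n - 1) / (q - 1)"
        using card' by simp
    qed
    also have "\<dots> = (q ^ dim T - q ^ dim S) * (real (card (?H S)) - (q ^ n - 1) / (q - 1))"
      using Suc.prems by (simp add: real_card_diff_subspace T)
    finally have *: "real (card (?H S)) * (q ^ dim T - q ^ (dim T - 1))
        = (q ^ dim T - q ^ dim S) * (real (card (?H S)) - (q ^ n - 1) / (q - 1))" .
    have cancel: "(a - 1) * ((q - 1) * c) = (a - 1) * (q * a - 1)"
      if eq: "c * (b * q * a - b * a) = (b * q * a - b) * (c - r)" and "(q - 1) * r = a - 1" "b \<noteq> 0"
      for a b c r :: real
    proof -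
      have "b * (c * (q - 1) * a) = b * ((q * a - 1) * (c - r))"
        using eq by (simp add: algebra_simps)
      then have "c * (q - 1) * a = (q * a - 1) * (c - r)"
        using that(3) by simp
      then have "(a - 1) * c = (q * a - 1) * r"
        by (simp add: algebra_simps)
      then have "(a - 1) * ((q - 1) * c) = (q * a - 1) * ((q - 1) * r)"
        by (metis mult.left_commute)
      then show ?thesis unfolding that(2) by (simp add: mult_ac)
    qed
    have "(q ^ n - 1) * ((q - 1) * real (card (?H S))) = (q ^ n - 1) * (q * q ^ n - 1)"
      by (rule cancel[of _ "q ^ dim S" _ "(q ^ n - 1) / (q - 1)"])
         (use * q_gt_1 in \<open>simp_all add: dT power_add mult_ac\<close>)
    moreover have "q ^ n \<noteq> 1"
      using False q_gt_1 one_less_power[of q n] by force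
    ultimately have "(q - 1) * real (card (?H S)) = q * q ^ n - 1" by simp
    then show ?thesis by (simp add: dT)
  qed
qed

lemma card_covered_eq_card_covering:
  assumes S: "subspace S" and T: "subspace T" and nsub: "\<not> S \<subseteq> T"
  shows "card {Y. subspace Y \<and> Y \<subseteq> S \<and> dim S = dim Y + 1 \<and> Y \<subseteq> T}
       = card {Y. subspace Y \<and> T \<subseteq> Y \<and> dim Y = dim T + 1 \<and> S \<subseteq> Y}"
    (is "card ?L = card ?R")
proof -
  let ?sum = "{x + y |x y. x \<in> S \<and> y \<in> T}"
  have modular: "dim ?sum + dim (S \<inter> T) = dim S + dim T"
    by (rule dim_sums_Int[OF S T])
  have sub_int: "subspace (S \<inter> T)" and sub_sum: "subspace ?sum"
    using S T by (auto intro: subspace_inter subspace_sums)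
  have "S \<subseteq> ?sum" "T \<subseteq> ?sum"
    using subspace_0[OF S] subspace_0[OF T] by force+
  have sum_least: "?sum \<subseteq> Y" if "subspace Y" "S \<subseteq> Y" "T \<subseteq> Y" for Y
    using that by (auto intro: subspace_add)
  have int_less: "dim (S \<inter> T) < dim S"
    using subspace_dim_equal[OF sub_int S] nsub by fastforce
  have L: "Y = S \<inter> T \<and> dim S = dim (S \<inter> T) + 1" if "Y \<in> ?L" for Y
  proof -
    have "Y = S \<inter> T"
      using that int_less by (intro subspace_dim_equal[OF _ sub_int]) auto
    then show ?thesis using that by auto
  qed
  have R: "Y = ?sum \<and> dim S = dim (S \<inter> T) + 1" if "Y \<in> ?R" for Y
  proof -
    have "?sum \<subseteq> Y" using that by (intro sum_least) auto
    moreover have "dim Y \<le> dim ?sum" using that int_less modular by auto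
    ultimately have "?sum = Y"
      using that sub_sum by (intro subspace_dim_equal) auto
    moreover from this have "dim S = dim (S \<inter> T) + 1" using that modular by auto
    ultimately show ?thesis by simp
  qed
  show ?thesis
  proof (cases "dim S = dim (S \<inter> T) + 1")
    case True
    have "?L = {S \<inter> T}"
    proof (intro set_eqI iffI)
      fix Y assume "Y \<in> {S \<inter> T}"
      then show "Y \<in> ?L" using sub_int True by simp
    next
      fix Y assume "Y \<in> ?L"
      from L[OF this] show "Y \<in> {S \<inter> T}" by simp
    qed
    moreover have "?R = {?sum}"
    proof (intro set_eqI iffI)
      fix Y assume "Y \<in> {?sum}"
      moreover have "dim ?sum = dim T + 1" using modular True by linarith
      ultimately show "Y \<in> ?R" using sub_sum \<open>S \<subseteq> ?sum\<close> \<open>T \<subseteq> ?sum\<close> by simp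
    next
      fix Y assume "Y \<in> ?R"
      from R[OF this] show "Y \<in> {?sum}" by simp
    qed
    ultimately show ?thesis by (simp only: card.insert card.empty finite.emptyI empty_iff not_False_eq_True)
  next
    case False
    then have "?L = {}" "?R = {}" using L R by blast+
    then show ?thesis by (metis card.empty)
  qed
qed

end

section \<open>Eigenspaces and flags\<close>

lemma matrix_vector_scale: "(A :: complex^'n^'m) *v (c *s x) = c *s (A *v x)"
  by (simp add: vec_eq_iff matrix_vector_mult_def sum_distrib_left mult_ac)

lemma matrix_eq_on_span:
  fixes A B :: "complex^'n^'m"
  assumes "vec.span S = UNIV" and "\<And>v. v \<in> S \<Longrightarrow> A *v v = B *v v"
  shows "A = B"
proof -
  have "A *v v = B *v v" for v
  proof -
    have "v \<in> vec.span S" using assms(1) by simp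
    then show ?thesis
      by (induction rule: vec.span_induct_alt)
         (simp_all add: matrix_vector_right_distrib matrix_vector_scale assms(2))
  qed
  then show ?thesis by (simp add: matrix_eq)
qed

lemma sum_matrix_vector_mult:
  fixes E :: "'i \<Rightarrow> complex^'n^'m"
  shows "(\<Sum>i\<in>I. E i) *v v = (\<Sum>i\<in>I. E i *v v)"
  by (induction I rule: infinite_finite_induct) (simp_all add: matrix_vector_mult_add_rdistrib)

lemma scale_matrix_vector_mult: "scale_matrix c M *v v = c *s (M *v v)"
  by (simp add: scale_matrix_def map_matrix_def vec_eq_iff matrix_vector_mult_def
      sum_distrib_left mult.assoc)

lemma
  fixes A :: "complex^'n^'n"
  assumes "invertible A"
  shows matrix_inv_right: "A ** matrix_inv A = mat 1"
    and matrix_inv_left: "matrix_inv A ** A = mat 1"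
  using someI_ex[OF assms[unfolded invertible_def]] by (simp_all add: matrix_inv_def)

lemma diagonalizable_if_eigenvectors_span:
  fixes A :: "complex^'n^'n"
  assumes "vec.span (\<Union>\<theta>. eigenspace A \<theta>) = UNIV"
  shows "diagonalizable A"
proof -
  let ?V = "\<Union>\<theta>. eigenspace A \<theta>"
  obtain S where S: "S \<subseteq> ?V" "vec.independent S" "?V \<subseteq> vec.span S"
    using vec.maximal_independent_subset[of ?V] by blast
  have span_S: "vec.span S = UNIV"
    using S(3) assms vec.span_mono[OF S(3)] by (simp add: vec.span_span top.extremum_unique)
  have "finite S" using S(2) vec.finiteI_independent by blast
  moreover have "card S = CARD('n)"
    using S(2) span_S vec.dim_eq_card_independent[OF S(2)] vec.dim_span[of S]
    by (simp add: vec_dim_card card_cart_basis)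
  ultimately obtain p :: "'n \<Rightarrow> complex^'n" where p: "bij_betw p UNIV S"
    using finite_same_card_bij[of "UNIV :: 'n set" S] by auto
  have "\<forall>i. \<exists>\<theta>. A *v p i = \<theta> *s p i"
    using bij_betwE[OF p] S(1) by (force simp: eigenspace_def)
  then obtain \<theta> where \<theta>: "\<And>i. A *v p i = \<theta> i *s p i" by metis
  define P :: "complex^'n^'n" where "P = (\<chi> i j. p j $ i)"
  define D :: "complex^'n^'n" where "D = (\<chi> i j. if i = j then \<theta> i else 0)"
  have "columns P = S"
    using bij_betw_imp_surj_on[OF p] by (auto simp: columns_def column_def P_def image_def)
  then obtain Q where "P ** Q = mat 1"
    using matrix_right_invertible_span_columns[of P] span_S by blast
  then have inv: "invertible P"
    using matrix_left_right_inverse by (auto simp: invertible_def)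
  have "A ** P = P ** D"
  proof -
    have "(A ** P) $ i $ j = (P ** D) $ i $ j" for i j
      using arg_cong[OF \<theta>[of j], of "\<lambda>v. v $ i"]
      by (simp add: matrix_matrix_mult_def matrix_vector_mult_def P_def D_def mult.commute
          if_distrib[of "\<lambda>x. _ * x"] sum.delta cong: if_cong)
    then show ?thesis by (simp add: vec_eq_iff)
  qed
  then have "A ** (P ** matrix_inv P) = P ** D ** matrix_inv P"
    by (simp add: matrix_mul_assoc)
  then have "A = P ** D ** matrix_inv P"
    by (simp add: matrix_inv_right[OF inv])
  then show ?thesis
    unfolding diagonalizable_def using inv
    by (intro exI[of _ P] exI[of _ D]) (simp add: D_def)
qed

lemma primitive_idempotent_exists:
  fixes A :: "complex^'n^'n"
  assumes "diagonalizable A" and "is_eigenvalue A \<theta>"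
  shows "\<exists>E. primitive_idempotent A \<theta> E"
proof -
  obtain P D :: "complex^'n^'n" where inv: "invertible P"
    and D: "\<And>i j. i \<noteq> j \<Longrightarrow> D $ i $ j = 0" and A: "A = P ** D ** matrix_inv P"
    using assms(1) unfolding diagonalizable_def by blast
  define E where "E = P ** (\<chi> i j. if i = j \<and> D $ i $ i = \<theta> then 1 else 0) ** matrix_inv P"
  have "E *v v = (if \<mu> = \<theta> then v else 0)" if v: "v \<in> eigenspace A \<mu>" for v \<mu>
  proof -
    define w where "w = matrix_inv P *v v"
    have v_eq: "v = P *v w"
      by (simp add: w_def matrix_vector_mul_assoc matrix_inv_right[OF inv])
    have "D *v w = (matrix_inv P ** P) *v (D *v w)"
      by (simp add: matrix_inv_left[OF inv])
    also have "\<dots> = matrix_inv P *v (A *v v)"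
      by (simp add: A w_def matrix_vector_mul_assoc matrix_mul_assoc)
    also have "\<dots> = \<mu> *s w"
      using v by (simp add: eigenspace_def matrix_vector_scale w_def)
    finally have Dw: "D *v w = \<mu> *s w" .
    have "D $ i $ i * w $ i = \<mu> * w $ i" for i
    proof -
      have "(D *v w) $ i = (\<Sum>j\<in>{i}. D $ i $ j * w $ j)"
        unfolding matrix_vector_mult_def vec_lambda_beta
        by (rule sum.mono_neutral_right) (auto simp: D)
      then have "(D *v w) $ i = D $ i $ i * w $ i" by simp
      then show ?thesis by (simp only: Dw vector_smult_component)
    qed
    then have "w $ i = 0" if "D $ i $ i \<noteq> \<mu>" for i
      using that by (metis mult_cancel_right)
    then have "(\<chi> i j. if i = j \<and> D $ i $ i = \<theta> then 1 else 0) *v w = (if \<mu> = \<theta> then w else 0)"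
      by (auto simp: vec_eq_iff matrix_vector_mult_def if_distrib[of "\<lambda>x. x * _"] sum.delta
          if_if_eq_conj[symmetric] cong: if_cong)
    moreover have "E *v v = P *v ((\<chi> i j. if i = j \<and> D $ i $ i = \<theta> then 1 else 0) *v w)"
      by (simp add: E_def w_def matrix_vector_mul_assoc matrix_mul_assoc)
    ultimately show ?thesis using v_eq by simp
  qed
  then show ?thesis
    unfolding primitive_idempotent_def using assms by (intro exI[of _ E]) auto
qed

text \<open>
  A complete flag on whose successive quotients \<open>A\<close> acts by the distinct scalars \<open>lam k\<close>; then \<open>F k\<close>
  is the sum of the eigenspaces for \<open>lam k, \<dots>, lam N\<close>.
\<close>

locale eigenflag =
  fixes A :: "complex^'n^'n" and F :: "nat \<Rightarrow> (complex^'n) set" and lam :: "nat \<Rightarrow> complex"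
    and N :: nat
  assumes subspace_F: "\<And>k. vec.subspace (F k)"
    and F_0: "F 0 = UNIV"
    and F_Suc_N: "F (Suc N) = {0}"
    and F_decreasing: "\<And>k. k \<le> N \<Longrightarrow> F (Suc k) \<subset> F k"
    and step: "\<And>k v. k \<le> N \<Longrightarrow> v \<in> F k \<Longrightarrow> A *v v - lam k *s v \<in> F (Suc k)"
    and inj_lam: "inj_on lam {..N}"
begin

lemma eigenvector_in_F:
  assumes "v \<in> eigenspace A \<theta>" and "k \<le> Suc N" and "\<And>j. j < k \<Longrightarrow> \<theta> \<noteq> lam j"
  shows "v \<in> F k"
  using assms(2,3)
proof (induction k)
  case 0
  then show ?case by (simp add: F_0)
next
  case (Suc k)
  have "v \<in> F k" using Suc by simp
  then have "A *v v - lam k *s v \<in> F (Suc k)" using Suc.prems by (intro step) auto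
  then have "inverse (\<theta> - lam k) *s (A *v v - lam k *s v) \<in> F (Suc k)"
    by (rule vec.subspace_scale[OF subspace_F])
  moreover have "A *v v - lam k *s v = (\<theta> - lam k) *s v"
    using assms(1) by (simp add: eigenspace_def vector_ssub_ldistrib vec.scale_left_diff_distrib)
  ultimately have "(inverse (\<theta> - lam k) * (\<theta> - lam k)) *s v \<in> F (Suc k)"
    by (simp only: vector_smult_assoc)
  then show ?case using Suc.prems(2)[of k] by simp
qed

lemma F_subset_span_eigenspaces:
  assumes "k \<le> Suc N"
  shows "F k \<subseteq> vec.span (\<Union>j\<in>{k..N}. eigenspace A (lam j))"
  using assms
proof (induction "Suc N - k" arbitrary: k)
  case 0
  then have "k = Suc N" by simp
  then show ?case by (simp add: F_Suc_N vec.span_zero)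
next
  case (Suc n)
  then have k: "k \<le> N" by simp
  let ?S = "\<lambda>k. vec.span (\<Union>j\<in>{k..N}. eigenspace A (lam j))"
  let ?T = "\<lambda>v. A *v v - lam k *s v"
  have diff: "?T (v - u) = ?T v - ?T u" for u v
    by (simp add: matrix_vector_mult_diff_distrib vec.scale_right_diff_distrib)
  have surj: "\<exists>u\<in>?S (Suc k). ?T u = w" if "w \<in> ?S (Suc k)" for w
    using that
  proof (induction rule: vec.span_induct_alt)
    case base
    show ?case by (intro bexI[of _ 0]) (auto simp: vec.span_zero)
  next
    case (step c x y)
    then obtain j where j: "Suc k \<le> j" "j \<le> N" "x \<in> eigenspace A (lam j)" by auto
    then have ne: "lam j \<noteq> lam k" using inj_lam k by (auto dest: inj_onD)
    obtain u where u: "u \<in> ?S (Suc k)" "?T u = y" using step by blast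
    let ?u = "(c * inverse (lam j - lam k)) *s x + u"
    have "?T x = (lam j - lam k) *s x"
      using j by (simp add: eigenspace_def vec.scale_left_diff_distrib)
    moreover have "?T ?u = (c * inverse (lam j - lam k)) *s ?T x + ?T u"
      by (simp add: matrix_vector_right_distrib matrix_vector_scale vec.scale_right_diff_distrib
          vec.scale_right_distrib vector_smult_assoc mult_ac)
    ultimately have "?T ?u = (c * inverse (lam j - lam k) * (lam j - lam k)) *s x + y"
      by (simp only: vector_smult_assoc u)
    then have "?T ?u = c *s x + y" using ne by simp
    moreover have "?u \<in> ?S (Suc k)"
      using j by (intro vec.span_add[OF vec.span_scale[OF vec.span_base] u(1)]) auto
    ultimately show ?case by blast
  qed
  show ?case
  proof
    fix v assume "v \<in> F k"
    moreover have "n = Suc N - Suc k" using Suc.hyps(2) by simp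
    ultimately have "?T v \<in> ?S (Suc k)" using step k Suc.hyps(1)[of "Suc k"] by auto
    then obtain u where u: "u \<in> ?S (Suc k)" "?T u = ?T v" using surj by blast
    then have "v - u \<in> eigenspace A (lam k)"
      using diff[of v u] by (simp add: eigenspace_def)
    then have "v - u \<in> ?S k" using k by (intro vec.span_base) auto
    moreover have "u \<in> ?S k"
      by (rule vec.span_mono[THEN subsetD, OF _ u(1)]) (intro UN_mono; simp)
    ultimately have "(v - u) + u \<in> ?S k" by (rule vec.span_add)
    then show "v \<in> ?S k" by simp
  qed
qed

lemma span_eigenspaces: "vec.span (\<Union>j\<in>{..N}. eigenspace A (lam j)) = UNIV"
  using F_subset_span_eigenspaces[of 0] by (auto simp: F_0 atLeast0AtMost)

lemma diagonalizable: "diagonalizable A"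
proof (rule diagonalizable_if_eigenvectors_span)
  have "vec.span (\<Union>j\<in>{..N}. eigenspace A (lam j)) \<subseteq> vec.span (\<Union>\<theta>. eigenspace A \<theta>)"
    by (rule vec.span_mono) blast
  then show "vec.span (\<Union>\<theta>. eigenspace A \<theta>) = UNIV" by (auto simp: span_eigenspaces)
qed

lemma is_eigenvalue_lam:
  assumes "k \<le> N"
  shows "is_eigenvalue A (lam k)"
proof (rule ccontr)
  assume "\<not> is_eigenvalue A (lam k)"
  then have triv: "eigenspace A (lam k) \<subseteq> {0}" by (auto simp: is_eigenvalue_def)
  have "eigenspace A (lam j) \<subseteq> F (Suc k)" if "j \<in> {k..N}" for j
  proof (cases "j = k")
    case True
    then show ?thesis using triv vec.subspace_0[OF subspace_F] by auto
  next
    case False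
    then show ?thesis using that assms inj_lam
      by (auto intro!: eigenvector_in_F[of _ "lam j"] dest!: inj_onD)
  qed
  then have "vec.span (\<Union>j\<in>{k..N}. eigenspace A (lam j)) \<subseteq> F (Suc k)"
    by (intro vec.span_minimal subspace_F UN_least)
  then show False
    using F_subset_span_eigenspaces[of k] F_decreasing[of k] assms by auto
qed

lemma is_eigenvalue_iff: "is_eigenvalue A \<theta> \<longleftrightarrow> \<theta> \<in> lam ` {..N}"
proof
  assume "is_eigenvalue A \<theta>"
  then obtain v where v: "v \<noteq> 0" "v \<in> eigenspace A \<theta>" by (auto simp: is_eigenvalue_def)
  show "\<theta> \<in> lam ` {..N}"
  proof (rule ccontr)
    assume "\<theta> \<notin> lam ` {..N}"
    then have "v \<in> F (Suc N)" by (intro eigenvector_in_F[OF v(2)]) auto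
    then show False using v F_Suc_N by simp
  qed
qed (auto intro: is_eigenvalue_lam)

lemma idempotent_vanishes_on_F:
  assumes "E ** A = scale_matrix (lam l) E" and "l < k" "k \<le> Suc N" "w \<in> F k"
  shows "E *v w = 0"
  using assms(2-)
proof (induction "Suc N - k" arbitrary: k w)
  case 0
  then have "k = Suc N" by simp
  then show ?case using 0 by (simp add: F_Suc_N)
next
  case (Suc n)
  have "E *v (A *v w - lam k *s w) = 0"
    using Suc.prems Suc.hyps(2) by (intro Suc.hyps(1)[of "Suc k"] step) auto
  moreover have "E *v (A *v w) = lam l *s (E *v w)"
    by (simp add: matrix_vector_mul_assoc assms(1) scale_matrix_vector_mult)
  ultimately have "(lam l - lam k) *s (E *v w) = 0"
    by (simp add: matrix_vector_mult_diff_distrib matrix_vector_scale vec.scale_left_diff_distrib)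
  moreover have "lam l \<noteq> lam k" using inj_lam Suc.prems Suc.hyps(2) by (auto dest!: inj_onD)
  ultimately show ?case by simp
qed

end

lemma idempotents_from_flag:
  fixes A :: "complex^'n^'n"
  assumes "eigenflag A F lam N"
  obtains E where "primitive_idempotents A = E ` {..N}"
    and "inj_on E {..N}"
    and "(\<Sum>i\<le>N. E i) = mat 1"
    and "\<And>i. i \<le> N \<Longrightarrow> E i ** A = scale_matrix (lam i) (E i)"
    and "\<And>i v. i \<le> N \<Longrightarrow> E i *v v \<in> eigenspace A (lam i)"
proof -
  interpret eigenflag A F lam N by fact
  have "\<forall>i\<in>{..N}. \<exists>E. primitive_idempotent A (lam i) E"
    using primitive_idempotent_exists[OF diagonalizable] is_eigenvalue_lam by simp
  then obtain E where "\<forall>i\<in>{..N}. primitive_idempotent A (lam i) (E i)" by metis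
  then have E: "\<And>i. i \<le> N \<Longrightarrow> primitive_idempotent A (lam i) (E i)" by simp
  have on_eigenvector: "E' *v v = (if i = j then v else 0)"
    if "primitive_idempotent A (lam i) E'" "v \<in> eigenspace A (lam j)" "i \<le> N" "j \<le> N" for E' v i j
    using that inj_lam is_eigenvalue_lam[of j]
    by (auto simp: primitive_idempotent_def dest: inj_onD)
  show thesis
  proof (rule that)
    show "primitive_idempotents A = E ` {..N}"
    proof (intro set_eqI iffI)
      fix E' assume "E' \<in> primitive_idempotents A"
      then obtain \<theta> where \<theta>: "primitive_idempotent A \<theta> E'"
        by (auto simp: primitive_idempotents_def)
      then obtain i where i: "i \<le> N" "\<theta> = lam i"
        using is_eigenvalue_iff by (auto simp: primitive_idempotent_def)
      have "E' = E i"
        by (rule matrix_eq_on_span[OF span_eigenspaces])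
           (use \<theta> i in \<open>auto simp: on_eigenvector[OF E] on_eigenvector\<close>)
      with i show "E' \<in> E ` {..N}" by simp
    qed (auto simp: primitive_idempotents_def intro: E)
    show "inj_on E {..N}"
    proof (rule inj_onI)
      fix i j assume ij: "i \<in> {..N}" "j \<in> {..N}" "E i = E j"
      obtain v where v: "v \<noteq> 0" "v \<in> eigenspace A (lam i)"
        using is_eigenvalue_lam[of i] ij by (auto simp: is_eigenvalue_def)
      then show "i = j"
        using on_eigenvector[OF E, of i v i] on_eigenvector[OF E, of j v i] ij
        by (auto split: if_splits)
    qed
    show "(\<Sum>i\<le>N. E i) = mat 1"
      by (rule matrix_eq_on_span[OF span_eigenspaces])
         (auto simp: sum_matrix_vector_mult on_eigenvector[OF E])
    show "E i ** A = scale_matrix (lam i) (E i)" if "i \<le> N" for i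
    proof (rule matrix_eq_on_span[OF span_eigenspaces])
      fix v assume "v \<in> (\<Union>j\<in>{..N}. eigenspace A (lam j))"
      then obtain j where j: "j \<le> N" "v \<in> eigenspace A (lam j)" by auto
      then have "A *v v = lam j *s v" by (simp add: eigenspace_def)
      then show "(E i ** A) *v v = scale_matrix (lam i) (E i) *v v"
        using that j
        by (simp add: scale_matrix_vector_mult matrix_vector_scale on_eigenvector[OF E] flip: matrix_vector_mul_assoc)
    qed
    show "E i *v v \<in> eigenspace A (lam i)" if "i \<le> N" for i v
    proof -
      have "A ** E i = scale_matrix (lam i) (E i)"
      proof (rule matrix_eq_on_span[OF span_eigenspaces])
        fix v assume "v \<in> (\<Union>j\<in>{..N}. eigenspace A (lam j))"
        then obtain j where j: "j \<le> N" "v \<in> eigenspace A (lam j)" by auto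
        then have "A *v v = lam j *s v" by (simp add: eigenspace_def)
        then show "(A ** E i) *v v = scale_matrix (lam i) (E i) *v v"
          using that j
          by (simp add: scale_matrix_vector_mult matrix_vector_scale on_eigenvector[OF E] flip: matrix_vector_mul_assoc)
      qed
      then show ?thesis
        by (simp add: eigenspace_def matrix_vector_mul_assoc scale_matrix_vector_mult)
    qed
  qed
qed

lemma tridiagonal_from_opposite_flags:
  fixes A B :: "complex^'n^'n"
  assumes F: "eigenflag A F (\<lambda>k. \<theta> (N - k)) N" and G: "eigenflag A G \<theta> N"
    and BF: "\<And>k v. v \<in> F k \<Longrightarrow> B *v v \<in> F (k - 1)"
    and BG: "\<And>k v. v \<in> G k \<Longrightarrow> B *v v \<in> G (k - 1)"
  shows "\<exists>E. idempotent_ordering A N E \<and>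
    (\<forall>i \<in> {0..int N}. (*v) B ` range ((*v) (E i)) \<subseteq>
          range ((*v) (E (i - 1))) + range ((*v) (E i)) + range ((*v) (E (i + 1))))"
proof -
  interpret F: eigenflag A F "\<lambda>k. \<theta> (N - k)" N by fact
  interpret G: eigenflag A G \<theta> N by fact
  obtain E where E: "primitive_idempotents A = E ` {..N}" "inj_on E {..N}"
    "(\<Sum>i\<le>N. E i) = mat 1"
    "\<And>i. i \<le> N \<Longrightarrow> E i ** A = scale_matrix (\<theta> i) (E i)"
    "\<And>i v. i \<le> N \<Longrightarrow> E i *v v \<in> eigenspace A (\<theta> i)"
    using idempotents_from_flag[OF G] by metis
  define E' where "E' k = (if 0 \<le> k \<and> k \<le> int N then E (nat k) else 0)" for k :: int
  have nat_image: "nat ` {0..int N} = {..N}"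
    by (auto simp: image_iff intro!: bexI[of _ "int _"])
  have inj_nat: "inj_on nat {0..int N}" by (auto intro!: inj_onI)
  have "bij_betw E' {0..int N} (primitive_idempotents A)"
  proof -
    have "bij_betw (E \<circ> nat) {0..int N} (primitive_idempotents A)"
      using E(1,2) nat_image inj_nat by (intro bij_betw_trans[of _ _ "{..N}"]) (auto simp: bij_betw_def)
    then show ?thesis by (rule bij_betw_cong[THEN iffD1, rotated]) (simp add: E'_def)
  qed
  then have "idempotent_ordering A N E'" by (simp add: idempotent_ordering_def E'_def)
  moreover have "B *v (E' i *v v) \<in> range ((*v) (E' (i - 1))) + range ((*v) (E' i)) + range ((*v) (E' (i + 1)))"
    if i: "i \<in> {0..int N}" for i v
  proof -
    define n where "n = nat i"
    have n: "n \<le> N" "i = int n" using i by (auto simp: n_def)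
    define u where "u = E n *v v"
    have u: "u \<in> eigenspace A (\<theta> n)" using E(5) n by (simp add: u_def)
    have \<theta>_inj: "\<theta> j = \<theta> l \<longleftrightarrow> j = l" if "j \<le> N" "l \<le> N" for j l
      using that G.inj_lam by (auto dest: inj_onD)
    have "u \<in> F (N - n)"
      by (rule F.eigenvector_in_F[OF u]) (use n in \<open>auto simp: \<theta>_inj\<close>)
    then have BuF: "B *v u \<in> F (N - n - 1)" by (rule BF)
    have "u \<in> G n"
      by (rule G.eigenvector_in_F[OF u]) (use n in \<open>auto simp: \<theta>_inj\<close>)
    then have BuG: "B *v u \<in> G (n - 1)" by (rule BG)
    have vanish: "E l *v (B *v u) = 0" if l: "l \<le> N" "l > n + 1 \<or> n > l + 1" for l
      using l(2)
    proof
      assume "l > n + 1"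
      then show ?thesis
        using l(1) n E(4)[of l]
        by (intro F.idempotent_vanishes_on_F[OF _ _ _ BuF, of _ "N - l"]) auto
    next
      assume "n > l + 1"
      then show ?thesis
        using l(1) n E(4)[of l]
        by (intro G.idempotent_vanishes_on_F[OF _ _ _ BuG, of _ l]) auto
    qed
    have "B *v u = (\<Sum>l\<in>nat ` {0..int N}. E l *v (B *v u))"
      by (simp add: nat_image E(3) flip: sum_matrix_vector_mult)
    also have "\<dots> = (\<Sum>k\<in>{0..int N}. E' k *v (B *v u))"
      by (subst sum.reindex[OF inj_nat]) (simp add: E'_def)
    also have "\<dots> = (\<Sum>k\<in>{-1..int N + 1}. E' k *v (B *v u))"
      by (rule sum.mono_neutral_left) (auto simp: E'_def)
    also have "\<dots> = (\<Sum>k\<in>{i - 1, i, i + 1}. E' k *v (B *v u))"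
    proof (rule sum.mono_neutral_right)
      show "\<forall>k\<in>{-1..int N + 1} - {i - 1, i, i + 1}. E' k *v (B *v u) = 0"
        using n by (auto simp: E'_def intro!: vanish)
    qed (use i in auto)
    also have "\<dots> = E' (i - 1) *v (B *v u) + E' i *v (B *v u) + E' (i + 1) *v (B *v u)"
      by (simp add: add.assoc)
    finally have "B *v u \<in> range ((*v) (E' (i - 1))) + range ((*v) (E' i)) + range ((*v) (E' (i + 1)))"
      by (metis set_plus_intro rangeI)
    moreover have "E' i *v v = u" using n by (simp add: E'_def u_def)
    ultimately show ?thesis by simp
  qed
  ultimately show ?thesis by blast
qed

section \<open>The adjacency matrix of the subspace lattice\<close>

locale subspace_lattice = finite_field_space smul Basis q
  for smul :: "'f::{field,finite} \<Rightarrow> 'v::ab_group_add \<Rightarrow> 'v" and Basis and q +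
  fixes vertex :: "'x::finite \<Rightarrow> 'v set" and N :: nat
  assumes enumerates: "enumerates_subspaces smul vertex"
    and dim_UNIV_eq: "dim (UNIV :: 'v set) = N"
begin

abbreviation d :: "'x \<Rightarrow> nat" where "d y \<equiv> dim (vertex y)"

abbreviation cov :: "'x \<Rightarrow> 'x \<Rightarrow> bool" where "cov y z \<equiv> covers smul (vertex y) (vertex z)"

lemma bij_vertex: "bij_betw vertex UNIV {S. subspace S}"
  using enumerates by (simp add: enumerates_subspaces_def)

lemma subspace_vertex [simp]: "subspace (vertex y)"
  using bij_betwE[OF bij_vertex] by simp

lemma vertex_eq_iff [simp]: "vertex y = vertex z \<longleftrightarrow> y = z"
  using bij_vertex by (auto simp: bij_betw_def dest: injD)

lemma obtain_vertex:
  assumes "subspace S"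
  obtains y where "vertex y = S"
  using assms bij_betw_imp_surj_on[OF bij_vertex] by (metis UNIV_I imageE mem_Collect_eq)

lemma d_le_N: "d y \<le> N"
  using dim_subset[of "vertex y" UNIV] by (simp only: dim_UNIV_eq) simp

lemma card_vertices: "card {z. P (vertex z)} = card {S. subspace S \<and> P S}"
proof -
  have "vertex ` {z. P (vertex z)} = {S. subspace S \<and> P S}"
    by (auto elim: obtain_vertex)
  then show ?thesis
    by (metis card_image inj_on_def vertex_eq_iff)
qed

lemma card_cov_below_top:
  assumes "vertex y \<subseteq> vertex w"
  shows "(q - 1) * real (card {z. cov z y \<and> vertex z \<subseteq> vertex w}) = q ^ (d w - d y) - 1"
  using card_vertices[of "\<lambda>Z. covers smul Z (vertex y) \<and> Z \<subseteq> vertex w"]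
    card_covers[OF _ _ assms] by (simp add: covers_def conj_ac)

lemma card_cov_above_bottom:
  assumes "vertex y \<subseteq> vertex w"
  shows "(q - 1) * real (card {z. cov w z \<and> vertex y \<subseteq> vertex z}) = q ^ (d w - d y) - 1"
  using card_vertices[of "\<lambda>Z. covers smul (vertex w) Z \<and> vertex y \<subseteq> Z"]
    card_hyperplanes[OF _ _ assms] by (simp add: covers_def conj_ac)

lemma card_cov_upper: "(q - 1) * real (card {z. cov z w}) = q ^ (N - d w) - 1"
proof -
  obtain t where t: "vertex t = UNIV" using obtain_vertex[OF subspace_UNIV] .
  have "d t = N" unfolding t by (rule dim_UNIV_eq)
  then show ?thesis using card_cov_below_top[of w t] t by simp
qed

lemma card_cov_lower: "(q - 1) * real (card {z. cov y z}) = q ^ d y - 1"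
proof -
  obtain o' where o': "vertex o' = {0}" using obtain_vertex[OF subspace_single_0] .
  have "vertex o' \<subseteq> vertex z" for z using subspace_0[of "vertex z"] o' by simp
  then show ?thesis using card_cov_above_bottom[of o' y] o' by simp
qed

lemma card_cov_swap:
  assumes "\<not> vertex y \<subseteq> vertex w"
  shows "card {z. cov y z \<and> vertex z \<subseteq> vertex w} = card {z. cov z w \<and> vertex y \<subseteq> vertex z}"
  using card_vertices[of "\<lambda>Z. covers smul (vertex y) Z \<and> Z \<subseteq> vertex w"]
    card_vertices[of "\<lambda>Z. covers smul Z (vertex w) \<and> vertex y \<subseteq> Z"]
    card_covered_eq_card_covering[OF _ _ assms] by (simp add: covers_def conj_ac)

lemma adj_matrix_mult:
  "(adj_matrix smul vertex \<phi> *v v) $ y =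
    (\<Sum>z | cov y z. v $ z) + of_real (\<phi> * q ^ d y) * (\<Sum>z | cov z y. v $ z)
    + of_real ((\<phi> - 1) / (q - 1) * q ^ d y) * v $ y"
proof -
  have "adj_matrix smul vertex \<phi> $ y $ z * v $ z =
      (if cov y z then v $ z else 0) + (if cov z y then of_real (\<phi> * q ^ d y) * v $ z else 0)
      + (if z = y then of_real ((\<phi> - 1) / (q - 1) * q ^ d y) * v $ z else 0)" for z
    by (auto simp: adj_matrix_def Let_def covers_def q_eq)
  then show ?thesis
    by (simp add: matrix_vector_mult_def sum.distrib sum.If_cases sum_distrib_left)
qed

definition down_vector :: "complex \<Rightarrow> 'x \<Rightarrow> complex^'x" where
  "down_vector c w = (\<chi> y. if vertex y \<subseteq> vertex w then c ^ d y else 0)"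

lemma down_vector_nth: "down_vector c w $ y = (if vertex y \<subseteq> vertex w then c ^ d y else 0)"
  by (simp add: down_vector_def)

lemma sum_if_const:
  "finite S \<Longrightarrow> (\<Sum>z\<in>S. if P z then a else (0::complex)) = of_nat (card {z \<in> S. P z}) * a"
  by (simp add: sum.If_cases Int_def)

text \<open>For \<open>y \<subseteq> w\<close>, the hypothesis \<open>root\<close> cancels the terms of the \<open>y\<close>-entry that depend on \<open>dim y\<close>.\<close>

lemma adj_matrix_down_vector:
  assumes c: "c \<noteq> 0" and root: "(1 - c) * (1 + of_real \<phi> * c) = 0"
  shows "adj_matrix smul vertex \<phi> *v down_vector c w =
    ((of_real \<phi> * c * of_real q ^ d w - of_real q ^ (N - d w) / c) / (of_real q - 1)) *s down_vector c w
    + (1 / c) *s (\<Sum>z | cov z w. down_vector c z)"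
proof -
  define Q where "Q = complex_of_real q"
  have Q: "Q - 1 \<noteq> 0" using q_gt_1 by (simp add: Q_def)
  define n1 where "n1 y = (of_nat (card {z. cov y z \<and> vertex z \<subseteq> vertex w}) :: complex)" for y
  define n2 where "n2 y = (of_nat (card {z. cov z y \<and> vertex z \<subseteq> vertex w}) :: complex)" for y
  define n3 where "n3 y = (of_nat (card {z. cov z w \<and> vertex y \<subseteq> vertex z}) :: complex)" for y
  have "(adj_matrix smul vertex \<phi> *v down_vector c w) $ y =
    ((of_real \<phi> * c * Q ^ d w - Q ^ (N - d w) / c) / (Q - 1)) * down_vector c w $ y
    + (1 / c) * (c ^ d y * n3 y)" for y
  proof -
    have "(\<Sum>z | cov y z. down_vector c w $ z)
        = (\<Sum>z | cov y z. if vertex z \<subseteq> vertex w then c ^ d y / c else 0)"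
      using c by (intro sum.cong) (auto simp: down_vector_nth covers_def)
    then have s1: "(\<Sum>z | cov y z. down_vector c w $ z) = n1 y * (c ^ d y / c)"
      by (simp add: sum_if_const n1_def)
    have "(\<Sum>z | cov z y. down_vector c w $ z)
        = (\<Sum>z | cov z y. if vertex z \<subseteq> vertex w then c ^ d y * c else 0)"
      by (intro sum.cong) (auto simp: down_vector_nth covers_def)
    then have s2: "(\<Sum>z | cov z y. down_vector c w $ z) = n2 y * (c ^ d y * c)"
      by (simp add: sum_if_const n2_def)
    have lhs: "(adj_matrix smul vertex \<phi> *v down_vector c w) $ y =
        n1 y * (c ^ d y / c) + of_real \<phi> * Q ^ d y * (n2 y * (c ^ d y * c))
        + (of_real \<phi> - 1) / (Q - 1) * Q ^ d y * down_vector c w $ y"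
      by (simp add: adj_matrix_mult s1 s2 Q_def)
    show ?thesis
    proof (cases "vertex y \<subseteq> vertex w")
      case True
      have to_complex: "(Q - 1) * of_nat n = Q ^ k - 1" if "(q - 1) * real n = q ^ k - 1" for n k
        using arg_cong[OF that, of complex_of_real] by (simp add: Q_def)
      have sub1: "{z. cov y z \<and> vertex z \<subseteq> vertex w} = {z. cov y z}"
        and sub2: "{z. cov z w \<and> vertex y \<subseteq> vertex z} = {z. cov z w}"
        using True by (auto simp: covers_def)
      have n1: "(Q - 1) * n1 y = Q ^ d y - 1"
        unfolding n1_def sub1 by (rule to_complex[OF card_cov_lower])
      have n2: "(Q - 1) * n2 y = Q ^ (d w - d y) - 1"
        unfolding n2_def by (rule to_complex[OF card_cov_below_top[OF True]])
      have n3: "(Q - 1) * n3 y = Q ^ (N - d w) - 1"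
        unfolding n3_def sub2 by (rule to_complex[OF card_cov_upper])
      have Qw: "Q ^ d w = Q ^ d y * Q ^ (d w - d y)"
        using dim_subset[OF True] by (simp flip: power_add)
      define a b e p where abe: "a = Q ^ d y" "b = Q ^ (d w - d y)" "e = Q ^ (N - d w)" "p = complex_of_real \<phi>"
      have "a - p * a * c * c + (p - 1) * a * c = 0"
      proof -
        have "a * ((1 - c) * (1 + p * c)) = 0" using root by (simp add: abe)
        then show ?thesis by (simp add: algebra_simps)
      qed
      then have "(a - 1) + p * a * c * c * (b - 1) + (p - 1) * a * c = p * c * c * (a * b) - e + (e - 1)"
        by (simp add: algebra_simps)
      then have "(Q - 1) * n1 y + p * a * c * c * ((Q - 1) * n2 y) + (p - 1) * a * c
          = p * c * c * (a * b) - e + (Q - 1) * n3 y"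
        unfolding n1 n2 n3 abe .
      moreover have "(Q - 1) * n1 y + p * a * c * c * ((Q - 1) * n2 y) + (p - 1) * a * c
          = c * (Q - 1) * (n1 y / c + p * a * c * n2 y + (p - 1) / (Q - 1) * a)"
        using c Q by (simp add: distrib_left mult_ac)
      moreover have "p * c * c * (a * b) - e + (Q - 1) * n3 y
          = c * (Q - 1) * ((p * c * (a * b) - e / c) / (Q - 1) + n3 y / c)"
      proof -
        have "c * (Q - 1) * (s / (Q - 1) + t / c) = c * s + (Q - 1) * t" for s t
          using c Q by (simp add: distrib_left)
        then show ?thesis using c by (simp add: right_diff_distrib mult_ac)
      qed
      ultimately have "n1 y / c + p * a * c * n2 y + (p - 1) / (Q - 1) * a
          = (p * c * (a * b) - e / c) / (Q - 1) + n3 y / c"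
        using c Q by simp
      then have "c ^ d y * (n1 y / c + p * a * c * n2 y + (p - 1) / (Q - 1) * a)
          = c ^ d y * ((p * c * (a * b) - e / c) / (Q - 1) + n3 y / c)"
        by (rule arg_cong)
      then show ?thesis
        unfolding lhs Qw using True by (simp add: down_vector_nth abe distrib_left mult_ac)
    next
      case False
      have "{z. cov z y \<and> vertex z \<subseteq> vertex w} = {}" using False by (auto simp: covers_def)
      then have "n2 y = 0" by (simp only: n2_def) simp
      moreover have "n1 y = n3 y"
        unfolding n1_def n3_def by (simp only: card_cov_swap[OF False])
      ultimately show ?thesis unfolding lhs using False by (simp add: down_vector_nth)
    qed
  qed
  moreover have "(\<Sum>z | cov z w. down_vector c z) $ y = c ^ d y * n3 y" for y
    by (simp add: down_vector_nth sum_if_const n3_def)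
  ultimately show ?thesis by (simp add: vec_eq_iff Q_def)
qed

definition diag :: "(nat \<Rightarrow> complex) \<Rightarrow> complex^'x^'x" where
  "diag g = (\<chi> y z. if y = z then g (d y) else 0)"

lemma diag_mult_nth: "(diag g *v v) $ y = g (d y) * v $ y"
  by (simp add: diag_def matrix_vector_mult_def if_distrib[of "\<lambda>a. a * _"] cong: if_cong)

lemma diag_down_vector:
  "diag (\<lambda>i. 1 / of_real q ^ i) *v down_vector c w =
    (1 / of_real q ^ d w) *s (down_vector c w + (of_real q - 1) *s (\<Sum>z | cov w z. down_vector c z))"
proof -
  define Q where "Q = complex_of_real q"
  have Q: "Q \<noteq> 0" using q_gt_1 by (simp add: Q_def)
  have "(diag (\<lambda>i. 1 / Q ^ i) *v down_vector c w) $ y =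
    (1 / Q ^ d w) * (down_vector c w $ y + (Q - 1) * (\<Sum>z | cov w z. down_vector c z) $ y)" for y
  proof -
    have sum: "(\<Sum>z | cov w z. down_vector c z) $ y
        = of_nat (card {z. cov w z \<and> vertex y \<subseteq> vertex z}) * c ^ d y"
      by (simp add: down_vector_nth sum_if_const)
    show ?thesis
    proof (cases "vertex y \<subseteq> vertex w")
      case True
      have n: "(Q - 1) * of_nat (card {z. cov w z \<and> vertex y \<subseteq> vertex z}) = Q ^ (d w - d y) - 1"
        using arg_cong[OF card_cov_above_bottom[OF True], of complex_of_real] by (simp add: Q_def)
      have Qw: "Q ^ d w = Q ^ d y * Q ^ (d w - d y)"
        using dim_subset[OF True] by (simp flip: power_add)
      have "(1 / Q ^ d w) * (down_vector c w $ y + (Q - 1) * (\<Sum>z | cov w z. down_vector c z) $ y)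
        = (1 / Q ^ d w) * (1 + (Q - 1) * of_nat (card {z. cov w z \<and> vertex y \<subseteq> vertex z})) * c ^ d y"
        unfolding sum using True by (simp add: down_vector_nth algebra_simps)
      also have "\<dots> = 1 / Q ^ d y * c ^ d y"
        unfolding n Qw using Q by simp
      finally show ?thesis using True by (simp add: diag_mult_nth down_vector_nth)
    next
      case False
      then have "{z. cov w z \<and> vertex y \<subseteq> vertex z} = {}" by (auto simp: covers_def)
      then have "(\<Sum>z | cov w z. down_vector c z) $ y = 0" unfolding sum by (simp only:) simp
      then show ?thesis using False by (simp add: diag_mult_nth down_vector_nth)
    qed
  qed
  then show ?thesis
    by (simp only: vec_eq_iff vector_smult_component vector_add_component Q_def simp_thms)
qed

definition flag :: "complex \<Rightarrow> nat \<Rightarrow> (complex^'x) set" where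
  "flag c k = vec.span (down_vector c ` {w. k \<le> d w})"

lemma subspace_flag: "vec.subspace (flag c k)"
  by (simp add: flag_def)

lemma down_vector_in_flag: "k \<le> d w \<Longrightarrow> down_vector c w \<in> flag c k"
  by (auto simp: flag_def intro: vec.span_base)

lemma flag_antimono: "k \<le> l \<Longrightarrow> flag c l \<subseteq> flag c k"
  unfolding flag_def by (rule vec.span_mono) auto

lemma flag_mult_subset:
  assumes "\<And>w. k \<le> d w \<Longrightarrow> M *v down_vector c w \<in> S" and "vec.subspace S" and "v \<in> flag c k"
  shows "M *v v \<in> S"
  using assms(3) unfolding flag_def
proof (induction rule: vec.span_induct_alt)
  case base
  then show ?case using vec.subspace_0[OF assms(2)] by simp
next
  case (step a x y)
  then show ?case
    using assms(1) vec.subspace_add[OF assms(2)] vec.subspace_scale[OF assms(2)]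
    by (auto simp: matrix_vector_right_distrib matrix_vector_scale)
qed

lemma span_down_vectors:
  assumes "c \<noteq> 0"
  shows "vec.span (range (down_vector c)) = UNIV"
proof -
  have "axis w 1 \<in> vec.span (range (down_vector c))" for w :: 'x
  proof (induction "d w" arbitrary: w rule: less_induct)
    case less
    let ?L = "{y. vertex y \<subset> vertex w}"
    have "down_vector c w = c ^ d w *s axis w 1 + (\<Sum>y\<in>?L. c ^ d y *s axis y 1)"
    proof -
      have "(\<Sum>y\<in>?L. c ^ d y *s axis y 1) $ z = (if vertex z \<subset> vertex w then c ^ d z else 0)" for z
      proof -
        have "(\<Sum>y\<in>?L. c ^ d y *s axis y (1::complex)) $ z = (\<Sum>y\<in>?L. if y = z then c ^ d z else 0)"
          unfolding sum_component by (rule sum.cong) (auto simp: axis_def)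
        then show ?thesis by simp
      qed
      then have "down_vector c w $ z = (c ^ d w *s axis w 1 + (\<Sum>y\<in>?L. c ^ d y *s axis y 1)) $ z" for z
        by (auto simp: down_vector_nth axis_def)
      then show ?thesis by (simp add: vec_eq_iff)
    qed
    moreover have "(\<Sum>y\<in>?L. c ^ d y *s axis y 1) \<in> vec.span (range (down_vector c))"
    proof (intro vec.span_sum vec.span_scale less)
      fix y assume "y \<in> ?L"
      then show "d y < d w"
        by (intro dim_psubset) (auto simp: span_eq_iff[THEN iffD2])
    qed
    moreover have "down_vector c w \<in> vec.span (range (down_vector c))"
      by (auto intro: vec.span_base)
    ultimately have "c ^ d w *s axis w 1 \<in> vec.span (range (down_vector c))"
      using vec.span_diff by fastforce
    then have "inverse (c ^ d w) *s (c ^ d w *s axis w 1) \<in> vec.span (range (down_vector c))"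
      by (rule vec.span_scale)
    then show ?case using assms by (simp add: vector_smult_assoc)
  qed
  then have "vec.span cart_basis \<subseteq> vec.span (range (down_vector c))"
    by (intro vec.span_minimal) (auto simp: cart_basis_def)
  then show ?thesis by (auto simp: vec.span_Basis)
qed

lemma inj_down_vector:
  assumes "c \<noteq> 0"
  shows "inj (down_vector c)"
proof (rule injI)
  fix w w' assume eq: "down_vector c w = down_vector c w'"
  have "vertex w \<subseteq> vertex w'" "vertex w' \<subseteq> vertex w"
    using arg_cong[OF eq, of "\<lambda>v. v $ w"] arg_cong[OF eq, of "\<lambda>v. v $ w'"] assms
    by (auto simp: down_vector_nth split: if_splits)
  then show "w = w'" by (metis subset_antisym vertex_eq_iff)
qed

lemma independent_down_vectors:
  assumes "c \<noteq> 0"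
  shows "vec.independent (range (down_vector c))"
proof (rule vec.card_le_dim_spanning[of _ UNIV])
  show "card (range (down_vector c)) \<le> vec.dim (UNIV :: (complex^'x) set)"
    by (simp add: card_image inj_down_vector[OF assms] vec_dim_card card_cart_basis)
qed (simp_all add: span_down_vectors[OF assms])

lemma flag_strict:
  assumes "c \<noteq> 0" "k \<le> N"
  shows "flag c (Suc k) \<subset> flag c k"
proof -
  have "card Basis = N" using dim_UNIV_eq by simp
  then obtain S where S: "S \<subseteq> Basis" "card S = k"
    using obtain_subset_with_card_n[of k Basis] assms(2) by blast
  obtain w where w: "vertex w = span S" using obtain_vertex[OF subspace_span] .
  have "independent S" using independent_Basis S(1) by (rule independent_mono)
  then have dw: "d w = k" using S(2) by (simp add: w dim_eq_card_independent)
  have "down_vector c w \<notin> flag c (Suc k)"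
  proof
    assume "down_vector c w \<in> flag c (Suc k)"
    moreover have "down_vector c ` {w. Suc k \<le> d w} \<subseteq> range (down_vector c) - {down_vector c w}"
      using inj_down_vector[OF assms(1)] dw by (auto dest: injD)
    ultimately have "down_vector c w \<in> vec.span (range (down_vector c) - {down_vector c w})"
      unfolding flag_def using vec.span_mono by blast
    then show False
      using independent_down_vectors[OF assms(1)] unfolding vec.dependent_def by blast
  qed
  moreover have "down_vector c w \<in> flag c k" by (simp add: down_vector_in_flag dw)
  moreover have "flag c (Suc k) \<subseteq> flag c k" by (simp add: flag_antimono)
  ultimately show ?thesis by blast
qed

lemma eigenflag_flag:
  assumes c: "c \<noteq> 0" and root: "(1 - c) * (1 + of_real \<phi> * c) = 0"
    and lam: "\<And>k. k \<le> N \<Longrightarrow>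
      lam k = (of_real \<phi> * c * of_real q ^ k - of_real q ^ (N - k) / c) / (of_real q - 1)"
    and inj: "inj_on lam {..N}"
  shows "eigenflag (adj_matrix smul vertex \<phi>) (flag c) lam N"
proof
  let ?A = "adj_matrix smul vertex \<phi>"
  show "flag c 0 = UNIV" using span_down_vectors[OF c] by (simp add: flag_def)
  have "{w. Suc N \<le> d w} = {}" using d_le_N by (simp add: not_less_eq_eq)
  then show "flag c (Suc N) = {0}" unfolding flag_def by (simp only: image_empty vec.span_empty)
  show "flag c (Suc k) \<subset> flag c k" if "k \<le> N" for k using flag_strict[OF c that] .
  show "?A *v v - lam k *s v \<in> flag c (Suc k)" if "k \<le> N" and v: "v \<in> flag c k" for k v
  proof -
    let ?M = "?A - scale_matrix (lam k) (mat 1)"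
    have M: "?M *v u = ?A *v u - lam k *s u" for u
      by (simp add: scale_matrix_def map_matrix_def vec_eq_iff matrix_vector_mult_def mat_def
          left_diff_distrib sum_subtractf if_distrib[of "\<lambda>a. _ * a"] if_distrib[of "\<lambda>a. a * _"] cong: if_cong)
    have "?M *v v \<in> flag c (Suc k)"
    proof (rule flag_mult_subset[OF _ subspace_flag v])
      fix w assume k: "k \<le> d w"
      have "?M *v down_vector c w = (lam (d w) - lam k) *s down_vector c w
          + (1 / c) *s (\<Sum>z | cov z w. down_vector c z)"
        unfolding M adj_matrix_down_vector[OF c root]
        by (simp add: lam[OF d_le_N] vec.scale_left_diff_distrib)
      moreover have "(lam (d w) - lam k) *s down_vector c w \<in> flag c (Suc k)"
      proof (cases "d w = k")
        case True
        then show ?thesis by (simp add: vec.subspace_0[OF subspace_flag])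
      next
        case False
        with k show ?thesis
          by (intro vec.subspace_scale[OF subspace_flag] down_vector_in_flag) simp
      qed
      moreover have "(1 / c) *s (\<Sum>z | cov z w. down_vector c z) \<in> flag c (Suc k)"
        using k by (intro vec.subspace_scale[OF subspace_flag] vec.subspace_sum[OF subspace_flag]
            down_vector_in_flag) (simp add: covers_def)
      ultimately show "?M *v down_vector c w \<in> flag c (Suc k)"
        by (simp add: vec.subspace_add[OF subspace_flag])
    qed
    then show ?thesis by (simp add: M)
  qed
qed (fact subspace_flag inj)+

lemma diag_flag:
  assumes "v \<in> flag c k"
  shows "diag (\<lambda>i. 1 / of_real q ^ i) *v v \<in> flag c (k - 1)"
proof (rule flag_mult_subset[OF _ subspace_flag assms])
  fix w assume k: "k \<le> d w"
  have "down_vector c w + (of_real q - 1) *s (\<Sum>z | cov w z. down_vector c z) \<in> flag c (k - 1)"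
    using k by (intro vec.subspace_add[OF subspace_flag] vec.subspace_scale[OF subspace_flag]
        vec.subspace_sum[OF subspace_flag] down_vector_in_flag) (auto simp: covers_def)
  then show "diag (\<lambda>i. 1 / of_real q ^ i) *v down_vector c w \<in> flag c (k - 1)"
    unfolding diag_down_vector by (rule vec.subspace_scale[OF subspace_flag])
qed

lemma diag_cong: "(\<And>i. i \<le> N \<Longrightarrow> g i = h i) \<Longrightarrow> diag g = diag h"
  by (auto simp: diag_def vec_eq_iff d_le_N)

lemma diag_mult: "diag g ** diag h = diag (\<lambda>i. g i * h i)"
  by (simp add: diag_def matrix_matrix_mult_def vec_eq_iff if_distrib[of "\<lambda>a. a * _"] cong: if_cong)

lemma diag_add: "diag g + diag h = diag (\<lambda>i. g i + h i)"
  by (simp add: diag_def vec_eq_iff)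

lemma diag_scale: "scale_matrix a (diag g) = diag (\<lambda>i. a * g i)"
  by (simp add: diag_def scale_matrix_def map_matrix_def vec_eq_iff)

lemma diag_const: "diag (\<lambda>_. a) = scale_matrix a (mat 1)"
  by (simp add: diag_def scale_matrix_def map_matrix_def vec_eq_iff mat_def)

lemma dual_idempotent_eq_diag: "dual_idempotent smul vertex i = diag (\<lambda>j. if j = i then 1 else 0)"
  by (auto simp: dual_idempotent_def diag_def vec_eq_iff)

lemma dual_adj_algebra_eq_range_diag: "dual_adj_algebra smul vertex N = range diag"
proof -
  interpret mat: vector_space scale_matrix by (rule vector_space_scale_matrix)
  show ?thesis
    unfolding dual_adj_algebra_def
  proof
    have "mat.subspace (range diag)"
    proof (rule mat.subspaceI)
      show "0 \<in> range diag"
        by (rule range_eqI[of _ _ "\<lambda>_. 0"]) (simp add: diag_def vec_eq_iff)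
    qed (auto simp: diag_add diag_scale)
    then show "mat.span (dual_idempotent smul vertex ` {0..N}) \<subseteq> range diag"
      by (rule mat.span_minimal[rotated]) (auto simp: dual_idempotent_eq_diag)
    show "range diag \<subseteq> mat.span (dual_idempotent smul vertex ` {0..N})"
    proof clarify
      fix g
      have "diag g = (\<Sum>i\<in>{0..N}. scale_matrix (g i) (dual_idempotent smul vertex i))"
        by (simp add: dual_idempotent_def diag_def scale_matrix_def map_matrix_def vec_eq_iff
            if_distrib[of "\<lambda>a. _ * a"] d_le_N cong: if_cong)
      also have "\<dots> \<in> mat.span (dual_idempotent smul vertex ` {0..N})"
        by (intro mat.span_sum mat.span_scale mat.span_base) auto
      finally show "diag g \<in> mat.span (dual_idempotent smul vertex ` {0..N})" .
    qed
  qed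
qed

lemma hull_diag:
  assumes inj: "inj_on g {..N}"
  shows "subalgebra hull {diag g} = dual_adj_algebra smul vertex N"
proof (rule antisym)
  interpret mat: vector_space scale_matrix by (rule vector_space_scale_matrix)
  have "subalgebra (dual_adj_algebra smul vertex N)"
    unfolding subalgebra_def
  proof (intro conjI)
    show "mat.subspace (dual_adj_algebra smul vertex N)" by (simp add: dual_adj_algebra_def)
    show "mat 1 \<in> dual_adj_algebra smul vertex N"
      unfolding dual_adj_algebra_eq_range_diag
      by (rule range_eqI[of _ _ "\<lambda>_. 1"]) (simp add: diag_def mat_def)
  qed (auto simp: dual_adj_algebra_eq_range_diag diag_mult)
  then show "subalgebra hull {diag g} \<subseteq> dual_adj_algebra smul vertex N"
    by (intro hull_minimal) (auto simp: dual_adj_algebra_eq_range_diag)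
  show "dual_adj_algebra smul vertex N \<subseteq> subalgebra hull {diag g}"
    unfolding hull_def
  proof (rule Inter_greatest, clarify)
    fix S M assume S: "subalgebra S" "{diag g} \<subseteq> S" and M: "M \<in> dual_adj_algebra smul vertex N"
    have sub: "mat.subspace S" "mat 1 \<in> S" "\<And>X Y. X \<in> S \<Longrightarrow> Y \<in> S \<Longrightarrow> X ** Y \<in> S"
      using S by (auto simp: subalgebra_def)
    have const: "diag (\<lambda>_. a) \<in> S" for a
      unfolding diag_const by (rule mat.subspace_scale[OF sub(1,2)])
    have linear: "diag (\<lambda>k. (g k - b) * a) \<in> S" for a b
    proof -
      have "diag (\<lambda>k. (g k - b) * a) = (diag g + diag (\<lambda>_. - b)) ** diag (\<lambda>_. a)"
        by (simp add: diag_add diag_mult)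
      then show ?thesis using S(2) const sub by (auto intro: mat.subspace_add)
    qed
    \<comment> \<open>Lagrange interpolation at the distinct diagonal entries\<close>
    have prod: "diag (\<lambda>k. \<Prod>j\<in>J. (g k - g j) / (g i - g j)) \<in> S" if "finite J" for i and J :: "nat set"
      using that
    proof (induction J)
      case empty
      then show ?case using const by simp
    next
      case (insert j J)
      then show ?case
        using sub(3)[OF linear[of "g j" "1 / (g i - g j)"] insert.IH] by (simp add: diag_mult)
    qed
    have "dual_idempotent smul vertex i \<in> S" if "i \<le> N" for i
    proof -
      have "dual_idempotent smul vertex i = diag (\<lambda>k. \<Prod>j\<in>{..N} - {i}. (g k - g j) / (g i - g j))"
        unfolding dual_idempotent_eq_diag
      proof (rule diag_cong)
        fix k assume k: "k \<le> N"
        show "(if k = i then 1 else 0) = (\<Prod>j\<in>{..N} - {i}. (g k - g j) / (g i - g j))"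
        proof (cases "k = i")
          case True
          have "g i \<noteq> g j" if "j \<in> {..N} - {i}" for j
            using that \<open>i \<le> N\<close> inj by (auto dest: inj_onD)
          then show ?thesis using True by simp
        next
          case False
          then show ?thesis using k by (auto simp: prod_zero_iff intro!: bexI[of _ k])
        qed
      qed
      then show ?thesis using prod by simp
    qed
    then have "dual_adj_algebra smul vertex N \<subseteq> S"
      unfolding dual_adj_algebra_def by (intro mat.span_minimal sub(1)) auto
    then show "M \<in> S" using M by blast
  qed
qed

lemma Q_polynomial_adj_matrix:
  assumes "\<phi> > 0"
  shows "Q_polynomial smul vertex N (adj_matrix smul vertex \<phi>)"
proof -
  define th where "th i = (\<phi> * q ^ (N - i) - q ^ i) / (q - 1)" for i
  define \<theta> where "\<theta> i = complex_of_real (th i)" for i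
  have "th j < th i" if "i < j" "j \<le> N" for i j
  proof -
    have "q ^ i < q ^ j" "q ^ (N - j) < q ^ (N - i)"
      using that q_gt_1 by (auto intro!: power_strict_increasing)
    then have "\<phi> * q ^ (N - j) - q ^ j < \<phi> * q ^ (N - i) - q ^ i"
      using assms by (smt (verit) mult_strict_left_mono)
    then show ?thesis using q_gt_1 by (simp add: th_def divide_strict_right_mono)
  qed
  then have inj: "inj_on \<theta> {..N}"
    by (intro linorder_inj_onI) (force simp: \<theta>_def)+
  have inj': "inj_on (\<lambda>k. \<theta> (N - k)) {..N}"
  proof (rule inj_onI)
    fix x y assume "x \<in> {..N}" "y \<in> {..N}" "\<theta> (N - x) = \<theta> (N - y)"
    moreover from this have "N - x = N - y" by (intro inj_onD[OF inj]) auto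
    ultimately show "x = y" by auto
  qed
  have F: "eigenflag (adj_matrix smul vertex \<phi>) (flag 1) (\<lambda>k. \<theta> (N - k)) N"
    by (rule eigenflag_flag[OF _ _ _ inj']) (auto simp: \<theta>_def th_def)
  have G: "eigenflag (adj_matrix smul vertex \<phi>) (flag (- 1 / of_real \<phi>)) \<theta> N"
    using assms by (intro eigenflag_flag[OF _ _ _ inj]) (auto simp: \<theta>_def th_def)
  obtain E where "idempotent_ordering (adj_matrix smul vertex \<phi>) N E"
    "\<forall>i \<in> {0..int N}. (*v) (diag (\<lambda>i. 1 / of_real q ^ i)) ` range ((*v) (E i)) \<subseteq>
          range ((*v) (E (i - 1))) + range ((*v) (E i)) + range ((*v) (E (i + 1)))"
    using tridiagonal_from_opposite_flags[where \<theta> = \<theta>, OF F G diag_flag diag_flag] by blast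
  moreover have "inj_on (\<lambda>i. 1 / complex_of_real q ^ i) {..N}"
    using q_gt_1 by (auto simp: inj_on_def power_inject_exp simp flip: of_real_power)
  ultimately show ?thesis
    unfolding Q_polynomial_def dual_adj_matrix_def using hull_diag by blast
qed

end

theorem theorem12p9:
  fixes smul :: "'f::{field,finite} \<Rightarrow> 'v::ab_group_add \<Rightarrow> 'v"
    and vertex :: "'x::finite \<Rightarrow> 'v set"
    and N :: nat
    and \<phi> :: real
  assumes "vector_space smul"
    and "N \<ge> 1"
    and "vector_space.dim smul (UNIV :: 'v set) = N"
    and "enumerates_subspaces smul vertex"
    and "\<phi> > 0"
  shows "Q_polynomial smul vertex N (adj_matrix smul vertex \<phi>)"
proof -
  interpret V: vector_space smul by fact
  obtain B where B: "B \<subseteq> UNIV" "V.independent B" "UNIV \<subseteq> V.span B" "card B = V.dim UNIV"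
    by (rule V.basis_exists)
  have "finite B" using B(4) assms(2,3) by (intro card_ge_0_finite) simp
  then interpret subspace_lattice smul B "real CARD('f)" vertex N
    using B assms by unfold_locales auto
  show ?thesis by (rule Q_polynomial_adj_matrix[OF assms(5)])
qed

end
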